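(* The numbers $a_t^E(K_n)$ of time-dependent assembly trees satisfying the edge gluing rule for the complete graphs $K_n$ satisfy $a_t^E(K_1)=a_t^E(K_2)=1$ and, for every integer $n\ge 3$, $$a^E_t(K_n)=\sum_{i=1}^{\lfloor n/2\rfloor}\frac{n!}{2^i\, i!\,(n-2i)!}\,a_t^E(K_{n-i}).$$
   Context: All graphs are finite and simple. Let $G=(V,E)$ be a connected graph with $|V|=N\ge 2$. A time-dependent assembly tree for $G$ is a rooted (unordered) tree each of whose nodes is labeled by a pair $(U,i)$ with $U\subseteq V$ and $i$ a nonnegative integer, such that: (1) the leaves are exactly $N$ in number, labeled $(v,0)$, one for each vertex $v\in V$ ($v$ identified with $\{v\}$); (2) each internal (non-leaf) node has at least two children; (3) the root is labeled $(V,m)$ for some $1\le m\le N-1$; (4) for each internal node $(U,i)$, $U$ is the union of the vertex sets labeling its children (equivalently, the set of leaves below it); (5) if $(U,i)$ and $(U',i')$ are adjacent nodes with $U\subseteq U'$, then $i<i'$; (6) for each $0\le i\le m$ there exists a node labeled $(U,i)$ for some $U\subseteq V$. For $N=1$, by convention the only time-dependent assembly tree is the single node $(v,0)$. Two such trees are the same if there is a label-preserving isomorphism of rooted trees between them. Such a tree satisfies the edge gluing rule if each internal node has exactly two children, with vertex sets $U_1$ and $U_2$ say, and there is an edge $v_1v_2\in E$ with $v_1\in U_1$ and $v_2\in U_2$. $a_t^E(G)$ is the number of time-dependent assembly trees for $G$ satisfying the edge gluing rule. $K_n$ is the complete graph on $n$ vertices. *)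

theory Defs
  imports Complex_Main "HOL-Library.Multiset"
begin

text \<open>
  A graph is a pair of a vertex set and a set of edges, each edge being a two-element set of
  vertices.
\<close>

type_synonym 'a ugraph = "'a set \<times> 'a set set"

definition simple_graph :: "'a ugraph \<Rightarrow> bool" where
  "simple_graph G \<longleftrightarrow> finite (fst G) \<and> (\<forall>e\<in>snd G. e \<subseteq> fst G \<and> card e = 2)"

definition connected_graph :: "'a ugraph \<Rightarrow> bool" where
  "connected_graph G \<longleftrightarrow>
     fst G \<noteq> {} \<and> (\<forall>u\<in>fst G. \<forall>v\<in>fst G. (u, v) \<in> {(x, y). {x, y} \<in> snd G}\<^sup>*)"

definition complete_graph :: "nat \<Rightarrow> nat ugraph" where
  "complete_graph n = ({..<n}, {{u, v} | u v. u < n \<and> v < n \<and> u \<noteq> v})"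

lemma simple_graph_complete_graph: "simple_graph (complete_graph n)"
  by (auto simp: simple_graph_def complete_graph_def)

lemma connected_graph_complete_graph:
  assumes "n \<ge> 1"
  shows "connected_graph (complete_graph n)"
proof -
  have "(u, v) \<in> {(x, y). {x, y} \<in> snd (complete_graph n)}\<^sup>*" if "u < n" "v < n" for u v
  proof (cases "u = v")
    case False
    with that have "(u, v) \<in> {(x, y). {x, y} \<in> snd (complete_graph n)}"
      by (auto simp: complete_graph_def)
    then show ?thesis by blast
  qed simp
  with assms show ?thesis
    by (auto simp: connected_graph_def complete_graph_def lessThan_empty_iff)
qed

text \<open>
  Finite rooted unordered trees with labelled nodes. As the children form a multiset, two terms
  are equal exactly if there is a label-preserving isomorphism of rooted trees between them, so
  that counting terms is counting isomorphism classes. A node is represented by the subtree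
  hanging from it.
\<close>

datatype 'l rtree = Node (label: 'l) (children: "'l rtree multiset")

primrec nodes :: "'l rtree \<Rightarrow> 'l rtree set" where
  "nodes (Node l ts) = insert (Node l ts) (\<Union> (set_mset (image_mset nodes ts)))"

primrec leaf_labels :: "'l rtree \<Rightarrow> 'l multiset" where
  "leaf_labels (Node l ts) =
     (if ts = {#} then {#l#} else \<Sum>\<^sub># (image_mset leaf_labels ts))"

definition internal_nodes :: "'l rtree \<Rightarrow> 'l rtree set" where
  "internal_nodes t = {s \<in> nodes t. children s \<noteq> {#}}"

definition adjacent_nodes :: "'l rtree \<Rightarrow> 'l rtree \<Rightarrow> 'l rtree \<Rightarrow> bool" where
  "adjacent_nodes t s s' \<longleftrightarrow>
     s \<in> nodes t \<and> s' \<in> nodes t \<and> (s \<in># children s' \<or> s' \<in># children s)"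

type_synonym 'a assembly_tree = "('a set \<times> nat) rtree"

abbreviation vset :: "'a assembly_tree \<Rightarrow> 'a set" where
  "vset s \<equiv> fst (label s)"

abbreviation time :: "'a assembly_tree \<Rightarrow> nat" where
  "time s \<equiv> snd (label s)"

text \<open>
  The notion is meant for connected simple graphs. The edges of the graph enter only through the
  gluing rule below. The graph with one vertex is treated separately: its only tree is a single
  node.
\<close>

definition time_dependent_assembly_tree :: "'a ugraph \<Rightarrow> 'a assembly_tree \<Rightarrow> bool" where
  "time_dependent_assembly_tree G t \<longleftrightarrow>
     (let V = fst G in
      if card V = 1 then t = Node (V, 0) {#}
      else
        (\<forall>s\<in>nodes t. vset s \<subseteq> V) \<and>
        leaf_labels t = image_mset (\<lambda>v. ({v}, 0)) (mset_set V) \<and>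
        (\<forall>s\<in>internal_nodes t. size (children s) \<ge> 2) \<and>
        (\<forall>s\<in>internal_nodes t. vset s = (\<Union>c\<in>set_mset (children s). vset c)) \<and>
        (\<forall>s s'. adjacent_nodes t s s' \<longrightarrow> vset s \<subseteq> vset s' \<longrightarrow> time s < time s') \<and>
        (\<exists>m. 1 \<le> m \<and> m \<le> card V - 1 \<and> label t = (V, m) \<and>
             (\<forall>i\<le>m. \<exists>s\<in>nodes t. time s = i)))"

definition edge_gluing_rule :: "'a ugraph \<Rightarrow> 'a assembly_tree \<Rightarrow> bool" where
  "edge_gluing_rule G t \<longleftrightarrow>
     (\<forall>s\<in>internal_nodes t. \<exists>c1 c2. children s = {#c1, c2#} \<and>
        (\<exists>v1\<in>vset c1. \<exists>v2\<in>vset c2. {v1, v2} \<in> snd G))"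

definition num_edge_assembly_trees :: "'a ugraph \<Rightarrow> nat" where
  "num_edge_assembly_trees G =
     card {t. time_dependent_assembly_tree G t \<and> edge_gluing_rule G t}"

end

theory Submission
  imports Defs "HOL-Library.Disjoint_Sets"
begin

text \<open>
  Read a time-dependent assembly tree from the bottom. At time \<open>k\<close> the maximal subtrees whose root
  has time at most \<open>k\<close> form a forest, the \<open>frontier\<close> of the tree at \<open>k\<close>. It starts, at time 0, as the
  set of single leaves, and it ends, at the time of the root, as the whole tree. Passing from time
  \<open>k\<close> to \<open>Suc k\<close> means choosing disjoint pairs of trees of the forest and joining each pair under a
  new root of time \<open>Suc k\<close>. In a complete graph the edge gluing rule permits every pair, and as
  every time up to that of the root must occur, at least one pair is chosen. The pairs can be read
  off from the new forest, so different choices are continued by different trees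
  (\<open>completions_eq_UN\<close>, \<open>joins_recoverable\<close>).

  A forest with \<open>n\<close> trees has \<open>n! / (2^i i! (n - 2i)!)\<close> choices of \<open>i\<close> disjoint pairs
  (\<open>card_matchings\<close>), and each leads to a forest with \<open>n - i\<close> trees. By induction on the number of
  trees, the number of ways to complete a forest to an assembly tree therefore depends on the
  number of its trees only (\<open>card_completions\<close>), single leaves and assembled trees counting alike.
  Hence a forest of \<open>n - i\<close> trees reached after the first step has as many
  completions as the forest of \<open>n - i\<close> leaves, which is the number of assembly trees of the complete
  graph on \<open>n - i\<close> vertices. Comparing forests within the same tree in this way avoids contracting
  edges and relabelling the vertices of the smaller graph.
\<close>

section \<open>Counting matchings of a set\<close>

definition matchings :: "'a set \<Rightarrow> nat \<Rightarrow> 'a set set set" where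
  "matchings A i = {M. (\<forall>e\<in>M. e \<subseteq> A \<and> card e = 2) \<and> disjoint M \<and> card M = i}"

lemma matchings_subset: "matchings A i \<subseteq> Pow (Pow A)"
  by (auto simp: matchings_def)

lemma finite_matchings: "finite A \<Longrightarrow> finite (matchings A i)"
  by (rule finite_subset[OF matchings_subset]) simp

lemma finite_matching: "finite A \<Longrightarrow> M \<in> matchings A i \<Longrightarrow> finite M"
  using matchings_subset[of A i] finite_subset[of M "Pow A"] by auto

lemma Union_matching:
  assumes "finite A" "M \<in> matchings A i"
  shows "\<Union>M \<subseteq> A" "card (\<Union>M) = 2 * i" "2 * i \<le> card A"
proof -
  show sub: "\<Union>M \<subseteq> A"
    using assms by (auto simp: matchings_def)
  have "card (\<Union>M) = (\<Sum>e\<in>M. card e)"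
    using assms by (intro card_Union_disjoint) (auto simp: matchings_def intro: finite_subset)
  also have "\<dots> = (\<Sum>e\<in>M. 2)"
    using assms by (intro sum.cong) (auto simp: matchings_def)
  finally show c: "card (\<Union>M) = 2 * i"
    using assms by (simp add: matchings_def)
  show "2 * i \<le> card A"
    using card_mono[OF assms(1) sub] c by simp
qed

text \<open>
  Both sides count the matchings with \<open>Suc i\<close> edges in which one edge is distinguished: choose the
  matching first, or choose the distinguished edge first and then match the remaining elements.
\<close>

lemma Suc_times_card_matchings:
  assumes "finite A"
  shows "Suc i * card (matchings A (Suc i)) =
    (\<Sum>e | e \<subseteq> A \<and> card e = 2. card (matchings (A - e) i))"
proof -
  let ?E = "{e. e \<subseteq> A \<and> card e = 2}"
  have "bij_betw (\<lambda>(M, e). (e, M - {e}))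
      (Sigma (matchings A (Suc i)) (\<lambda>M. M)) (Sigma ?E (\<lambda>e. matchings (A - e) i))"
  proof (rule bij_betw_byWitness[where f' = "\<lambda>(e, M). (insert e M, e)"])
    show "(\<lambda>(M, e). (e, M - {e})) ` Sigma (matchings A (Suc i)) (\<lambda>M. M)
        \<subseteq> Sigma ?E (\<lambda>e. matchings (A - e) i)"
    proof clarify
      fix M e assume M: "M \<in> matchings A (Suc i)" "e \<in> M"
      have "e' \<subseteq> A - e" if "e' \<in> M - {e}" for e'
        using M that unfolding matchings_def disjoint_def by blast
      moreover have "disjoint (M - {e})"
        using M by (auto simp: matchings_def disjoint_def)
      ultimately show "e \<in> ?E \<and> M - {e} \<in> matchings (A - e) i"
        using M by (auto simp: matchings_def)
    qed
    show "(\<lambda>(e, M). (insert e M, e)) ` Sigma ?E (\<lambda>e. matchings (A - e) i)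
        \<subseteq> Sigma (matchings A (Suc i)) (\<lambda>M. M)"
    proof clarify
      fix M e assume e: "e \<subseteq> A" "card e = 2" and M: "M \<in> matchings (A - e) i"
      have fin: "finite M"
        using finite_matching[OF _ M] assms by simp
      have "e \<noteq> {}" using e by auto
      with M have "e \<notin> M" by (auto simp: matchings_def)
      moreover have "disjoint (insert e M)"
        using M unfolding matchings_def disjoint_def by blast
      ultimately show "insert e M \<in> matchings A (Suc i) \<and> e \<in> insert e M"
        using M e fin by (auto simp: matchings_def)
    qed
    show "\<forall>x\<in>Sigma (matchings A (Suc i)) (\<lambda>M. M).
        (\<lambda>(e, M). (insert e M, e)) ((\<lambda>(M, e). (e, M - {e})) x) = x"
      by auto
    have "e \<notin> M" if "card e = 2" "M \<in> matchings (A - e) i" for e M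
    proof
      assume "e \<in> M"
      then have "e \<subseteq> A - e" using that(2) unfolding matchings_def by blast
      then have "e = {}" by blast
      with that(1) show False by simp
    qed
    then show "\<forall>x\<in>Sigma ?E (\<lambda>e. matchings (A - e) i).
        (\<lambda>(M, e). (e, M - {e})) ((\<lambda>(e, M). (insert e M, e)) x) = x"
      by auto
  qed
  then have "card (Sigma (matchings A (Suc i)) (\<lambda>M. M)) =
      card (Sigma ?E (\<lambda>e. matchings (A - e) i))"
    by (rule bij_betw_same_card)
  moreover have "card (Sigma (matchings A (Suc i)) (\<lambda>M. M)) = (\<Sum>M\<in>matchings A (Suc i). card M)"
    using assms by (intro card_SigmaI) (auto simp: finite_matchings intro: finite_matching)
  moreover have "(\<Sum>M\<in>matchings A (Suc i). card M) = (\<Sum>M\<in>matchings A (Suc i). Suc i)"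
    by (intro sum.cong) (auto simp: matchings_def)
  moreover have "card (Sigma ?E (\<lambda>e. matchings (A - e) i)) = (\<Sum>e\<in>?E. card (matchings (A - e) i))"
    using assms by (intro card_SigmaI) (auto intro: finite_matchings)
  ultimately show ?thesis by (simp add: algebra_simps)
qed

lemma card_matchings:
  assumes "finite A" "2 * i \<le> card A"
  shows "real (card (matchings A i)) =
    fact (card A) / (2 ^ i * fact i * fact (card A - 2 * i))"
  using assms
proof (induction i arbitrary: A)
  case 0
  have "M = {}" if "M \<in> matchings A 0" for M
    using finite_matching[OF _ that] that 0 by (auto simp: matchings_def)
  then have "matchings A 0 = {{}}" by (auto simp: matchings_def)
  then show ?case by simp
next
  case (Suc i)
  define n where "n = card A"
  let ?E = "{e. e \<subseteq> A \<and> card e = 2}"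
  let ?q = "fact (n - 2) / (2 ^ i * fact i * fact (n - 2 * Suc i)) :: real"
  have "real (card (matchings (A - e) i)) = ?q" if "e \<in> ?E" for e
  proof -
    have "card (A - e) = n - 2"
      using that Suc.prems by (auto simp: n_def card_Diff_subset finite_subset)
    then show ?thesis
      using Suc.IH[of "A - e"] Suc.prems by (simp add: n_def)
  qed
  then have "real (\<Sum>e\<in>?E. card (matchings (A - e) i)) = real (card ?E) * ?q"
    by simp
  also have "card ?E = n choose 2"
    using Suc.prems by (simp add: n_def n_subsets)
  also have "real (n choose 2) = fact n / (2 * fact (n - 2))"
    using Suc.prems by (subst binomial_fact) (auto simp: n_def)
  finally have "real (Suc i * card (matchings A (Suc i))) = fact n / (2 * fact (n - 2)) * ?q"
    by (subst Suc_times_card_matchings[OF Suc.prems(1)]) simp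
  then have "real (Suc i) * real (card (matchings A (Suc i))) =
      fact n / (2 * 2 ^ i * fact i * fact (n - 2 * Suc i))"
    by (simp only: of_nat_mult) (simp add: field_simps)
  then show ?case
    unfolding n_def by (simp add: field_simps del: of_nat_Suc)
qed

section \<open>Binary trees with increasing times\<close>

text \<open>
  A bottom-up description of the trees in question. Disjointness of the two vertex sets takes over
  two roles: it makes the leaf labels distinct, and it provides an edge of the complete graph
  between the two parts.
\<close>

inductive merge_tree :: "'a assembly_tree \<Rightarrow> bool" where
  leaf: "merge_tree (Node ({v}, 0) {#})"
| join: "merge_tree c1 \<Longrightarrow> merge_tree c2 \<Longrightarrow> vset c1 \<inter> vset c2 = {} \<Longrightarrow>
    time c1 < i \<Longrightarrow> time c2 < i \<Longrightarrow> merge_tree (Node (vset c1 \<union> vset c2, i) {#c1, c2#})"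

definition gapless :: "'a assembly_tree \<Rightarrow> bool" where
  "gapless t \<longleftrightarrow> (\<forall>i\<le>time t. \<exists>s\<in>nodes t. time s = i)"

lemma merge_tree_finite_nonempty: "merge_tree t \<Longrightarrow> finite (vset t) \<and> vset t \<noteq> {}"
  by (induction rule: merge_tree.induct) auto

lemma self_in_nodes: "t \<in> nodes t"
  by (cases t) auto

lemma merge_tree_nodes:
  "merge_tree t \<Longrightarrow> s \<in> nodes t \<Longrightarrow> merge_tree s \<and> vset s \<subseteq> vset t \<and> time s \<le> time t"
  by (induction rule: merge_tree.induct) (fastforce intro: merge_tree.intros)+

lemma merge_tree_child:
  assumes "merge_tree t" "c \<in># children t"
  shows "vset c \<subset> vset t" "time c < time t"
  using assms by (cases; use merge_tree_finite_nonempty in fastforce)+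

lemma merge_tree_leaf_labels:
  "merge_tree t \<Longrightarrow> leaf_labels t = image_mset (\<lambda>v. ({v}, 0)) (mset_set (vset t))"
proof (induction rule: merge_tree.induct)
  case (join c1 c2 i)
  then show ?case
    using merge_tree_finite_nonempty[OF join(1)] merge_tree_finite_nonempty[OF join(2)]
    by (simp add: mset_set_Union)
qed simp

lemma internal_nodes_join:
  "internal_nodes (Node l {#c1, c2#}) =
    insert (Node l {#c1, c2#}) (internal_nodes c1 \<union> internal_nodes c2)"
  by (auto simp: internal_nodes_def)

text \<open>
  A binary tree with \<open>N\<close> leaves has \<open>N - 1\<close> internal nodes. Only the distinct times are counted here,
  which is what bounds the time of the root of a gapless tree by \<open>N - 1\<close>.
\<close>

lemma card_times_le:
  "merge_tree t \<Longrightarrow>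
    finite (time ` internal_nodes t) \<and> card (time ` internal_nodes t) \<le> card (vset t) - 1"
proof (induction rule: merge_tree.induct)
  case (leaf v)
  then show ?case by (simp add: internal_nodes_def)
next
  case (join c1 c2 i)
  let ?T = "\<lambda>c. time ` internal_nodes c"
  note fin = merge_tree_finite_nonempty[OF join(1)] merge_tree_finite_nonempty[OF join(2)]
  have "0 < card (vset c1)" "0 < card (vset c2)"
    using fin by (auto simp: card_gt_0_iff)
  moreover have "card (vset c1 \<union> vset c2) = card (vset c1) + card (vset c2)"
    using fin join by (intro card_Un_disjoint) auto
  moreover have "card (insert i (?T c1 \<union> ?T c2)) \<le> Suc (card (?T c1) + card (?T c2))"
    using card_Un_le[of "?T c1" "?T c2"] join by (auto simp: card_insert_if)
  ultimately show ?case
    using join.IH by (auto simp: internal_nodes_join image_Un)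
qed

lemma gapless_time_le:
  assumes "merge_tree t" "gapless t"
  shows "time t \<le> card (vset t) - 1"
proof -
  have leaf: "time s = 0" if "s \<in> nodes t" "s \<notin> internal_nodes t" for s
    using merge_tree_nodes[OF assms(1) that(1)] that
    by (auto simp: internal_nodes_def elim: merge_tree.cases)
  have "{1..time t} \<subseteq> time ` internal_nodes t"
  proof
    fix i assume i: "i \<in> {1..time t}"
    then obtain s where s: "s \<in> nodes t" "time s = i"
      using assms(2) unfolding gapless_def by auto
    with leaf i have "s \<in> internal_nodes t" by fastforce
    with s(2) show "i \<in> time ` internal_nodes t" by blast
  qed
  then have "card {1..time t} \<le> card (time ` internal_nodes t)"
    using card_times_le[OF assms(1)] by (intro card_mono) auto
  then show ?thesis
    using card_times_le[OF assms(1)] by simp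
qed

section \<open>Assembly trees of the complete graph\<close>

text \<open>
  The vertex sets of two siblings are disjoint because the leaf labels are all distinct: the
  multiset of leaf labels splits along the two children, and a multiset without repetitions splits
  only into disjoint sets.
\<close>

lemma merge_treeI_of_leaf_labels:
  assumes "finite A"
    and "leaf_labels t = image_mset (\<lambda>v. ({v}, 0)) (mset_set A)"
    and "\<forall>s\<in>internal_nodes t. \<exists>c1 c2. children s = {#c1, c2#}"
    and "\<forall>s\<in>internal_nodes t. vset s = (\<Union>c\<in>set_mset (children s). vset c)"
    and "\<forall>s s'. adjacent_nodes t s s' \<longrightarrow> vset s \<subseteq> vset s' \<longrightarrow> time s < time s'"
  shows "merge_tree t \<and> vset t = A"
  using assms
proof (induction t arbitrary: A)
  case (Node l ts)
  show ?case
  proof (cases "ts = {#}")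
    case True
    with Node.prems(2) have "image_mset (\<lambda>v. ({v}, 0)) (mset_set A) = {#l#}" by simp
    moreover from this have "card A = 1"
      by (metis size_image_mset size_mset_set size_single)
    then obtain v where "A = {v}"
      by (auto simp: card_1_singleton_iff)
    ultimately show ?thesis
      using True by (auto intro: merge_tree.leaf)
  next
    case False
    let ?t = "Node l ts"
    have root: "?t \<in> internal_nodes ?t"
      using False by (simp add: internal_nodes_def)
    with Node.prems(3) obtain c1 c2 where ts: "ts = {#c1, c2#}"
      by fastforce
    have split: "image_mset (\<lambda>v. ({v}, 0)) (mset_set A) = leaf_labels c1 + leaf_labels c2"
      using Node.prems(2) ts by simp
    obtain B1 B2 where B: "mset_set A = B1 + B2"
      "leaf_labels c1 = image_mset (\<lambda>v. ({v}, 0)) B1"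
      "leaf_labels c2 = image_mset (\<lambda>v. ({v}, 0)) B2"
      using image_mset_eq_plusD[OF split] by blast
    define A1 A2 where "A1 = set_mset B1" and "A2 = set_mset B2"
    have A: "A = A1 \<union> A2"
      using B(1) Node.prems(1) unfolding A1_def A2_def
      by (metis finite_set_mset_mset_set set_mset_union)
    have fin: "finite A1" "finite A2"
      by (simp_all add: A1_def A2_def)
    have cnt: "count B1 v + count B2 v = (if v \<in> A then 1 else 0)" for v
      using B(1) Node.prems(1) by (metis count_mset_set(1,3) count_union)
    have disj: "A1 \<inter> A2 = {}"
    proof -
      have "False" if "v \<in># B1" "v \<in># B2" for v
        using cnt[of v] that by (auto simp flip: count_greater_zero_iff split: if_splits)
      then show ?thesis by (auto simp: A1_def A2_def)
    qed
    \<comment> \<open>No vertex occurs twice in \<open>B1 + B2\<close>, so each part is the multiset of its elements.\<close>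
    have B1: "B1 = mset_set A1"
    proof (rule multiset_eqI)
      fix v
      show "count B1 v = count (mset_set A1) v"
        using cnt[of v] by (cases "v \<in># B1")
          (auto simp: A1_def not_in_iff simp flip: count_greater_zero_iff split: if_splits)
    qed
    have B2: "B2 = mset_set A2"
    proof (rule multiset_eqI)
      fix v
      show "count B2 v = count (mset_set A2) v"
        using cnt[of v] by (cases "v \<in># B2")
          (auto simp: A2_def not_in_iff simp flip: count_greater_zero_iff split: if_splits)
    qed
    have sub: "internal_nodes c \<subseteq> internal_nodes ?t" "nodes c \<subseteq> nodes ?t" if "c \<in># ts" for c
      using that by (auto simp: internal_nodes_def)
    have adj: "adjacent_nodes c s s' \<Longrightarrow> adjacent_nodes ?t s s'" if "c \<in># ts" for c s s'
      using sub(2)[OF that] by (auto simp: adjacent_nodes_def)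
    have IH: "merge_tree c \<and> vset c = B"
      if c: "c \<in># ts" and B: "finite B" "leaf_labels c = image_mset (\<lambda>v. ({v}, 0)) (mset_set B)"
      for c B
    proof (rule Node.IH[OF c B])
      show "\<forall>s\<in>internal_nodes c. \<exists>c1 c2. children s = {#c1, c2#}"
        using Node.prems(3) sub(1)[OF c] by blast
      show "\<forall>s\<in>internal_nodes c. vset s = (\<Union>c\<in>set_mset (children s). vset c)"
        using Node.prems(4) sub(1)[OF c] by blast
      show "\<forall>s s'. adjacent_nodes c s s' \<longrightarrow> vset s \<subseteq> vset s' \<longrightarrow> time s < time s'"
        using Node.prems(5) adj[OF c] by blast
    qed
    have c1: "merge_tree c1 \<and> vset c1 = A1"
      by (rule IH) (simp_all add: ts fin B(2) B1)
    have c2: "merge_tree c2 \<and> vset c2 = A2"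
      by (rule IH) (simp_all add: ts fin B(3) B2)
    have v: "fst l = vset c1 \<union> vset c2"
      using Node.prems(4) root ts by fastforce
    have "time c < snd l" if "c \<in># ts" for c
    proof -
      have "adjacent_nodes ?t c ?t"
        using that sub(2)[OF that] self_in_nodes[of c] by (auto simp: adjacent_nodes_def)
      moreover have "vset c \<subseteq> vset ?t" using v that ts by auto
      ultimately show ?thesis using Node.prems(5) by fastforce
    qed
    then have "merge_tree (Node (vset c1 \<union> vset c2, snd l) {#c1, c2#})"
      using c1 c2 disj by (intro merge_tree.join) (auto simp: ts)
    moreover have "(vset c1 \<union> vset c2, snd l) = l"
      using v by (metis prod.collapse)
    ultimately show ?thesis
      using A c1 c2 v ts by simp
  qed
qed

text \<open>
  With two vertices or more, the root has children, which forces its time to be positive; the upper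
  bound on its time follows from the absence of gaps.
\<close>

lemma assembly_tree_complete_graph_iff:
  assumes "n \<ge> 2"
  shows "time_dependent_assembly_tree (complete_graph n) t \<and> edge_gluing_rule (complete_graph n) t
    \<longleftrightarrow> merge_tree t \<and> gapless t \<and> vset t = {..<n}" (is "?L \<longleftrightarrow> ?R")
proof
  assume L: ?L
  have "merge_tree t \<and> vset t = {..<n}"
  proof (rule merge_treeI_of_leaf_labels)
    show "\<forall>s\<in>internal_nodes t. \<exists>c1 c2. children s = {#c1, c2#}"
      using L unfolding edge_gluing_rule_def by blast
  qed (use L assms in \<open>auto simp: time_dependent_assembly_tree_def complete_graph_def Let_def\<close>)
  moreover have "gapless t"
    using L assms
    by (auto simp: time_dependent_assembly_tree_def complete_graph_def Let_def gapless_def)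
  ultimately show ?R by blast
next
  assume R: ?R
  have inner: "\<exists>c1 c2. children s = {#c1, c2#} \<and> merge_tree c1 \<and> merge_tree c2 \<and>
      vset c1 \<inter> vset c2 = {} \<and> vset s = vset c1 \<union> vset c2 \<and> vset s \<subseteq> {..<n}"
    if "s \<in> internal_nodes t" for s
  proof -
    have s: "merge_tree s" "children s \<noteq> {#}" "vset s \<subseteq> {..<n}"
      using that R merge_tree_nodes by (auto simp: internal_nodes_def)
    from s(1) show ?thesis
    proof cases
      case (leaf v)
      then show ?thesis using s(2) by simp
    next
      case (join c1 c2 i)
      then show ?thesis using s(3) by (intro exI[of _ c1] exI[of _ c2]) simp
    qed
  qed
  have "edge_gluing_rule (complete_graph n) t"
    unfolding edge_gluing_rule_def
  proof
    fix s assume "s \<in> internal_nodes t"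
    from inner[OF this] obtain c1 c2 where c: "children s = {#c1, c2#}" "merge_tree c1" "merge_tree c2"
      "vset c1 \<inter> vset c2 = {}" "vset c1 \<union> vset c2 \<subseteq> {..<n}"
      by auto
    then obtain v1 v2 where v: "v1 \<in> vset c1" "v2 \<in> vset c2"
      using merge_tree_finite_nonempty by blast
    have "v1 < n" "v2 < n" "v1 \<noteq> v2"
      using c(4,5) v by auto
    then have "{v1, v2} \<in> snd (complete_graph n)"
      unfolding complete_graph_def by auto
    with c v show "\<exists>c1 c2. children s = {#c1, c2#} \<and>
        (\<exists>v1\<in>vset c1. \<exists>v2\<in>vset c2. {v1, v2} \<in> snd (complete_graph n))"
      by blast
  qed
  moreover have "time_dependent_assembly_tree (complete_graph n) t"
  proof -
    \<comment> \<open>A child has a strictly smaller vertex set, so the inclusion says which node is the child.\<close>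
    have "time s < time s'" if "adjacent_nodes t s s'" "vset s \<subseteq> vset s'" for s s'
    proof -
      have "merge_tree s" "merge_tree s'"
        using that R merge_tree_nodes by (auto simp: adjacent_nodes_def)
      with that show ?thesis
        using merge_tree_child[of s s'] merge_tree_child[of s' s]
        by (auto simp: adjacent_nodes_def)
    qed
    moreover have "1 \<le> time t"
    proof -
      from R have "merge_tree t" by blast
      then show ?thesis
      proof cases
        case (leaf v)
        then have "card {..<n} = card {v}" using R by auto
        with assms show ?thesis by simp
      qed simp
    qed
    moreover have "time t \<le> n - 1"
      using gapless_time_le[of t] R by simp
    moreover have "\<forall>i\<le>time t. \<exists>s\<in>nodes t. time s = i"
      using R unfolding gapless_def by blast
    moreover have "\<forall>s\<in>nodes t. vset s \<subseteq> {..<n}"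
      using R merge_tree_nodes by blast
    moreover have "leaf_labels t = image_mset (\<lambda>v. ({v}, 0)) (mset_set {..<n})"
      using R merge_tree_leaf_labels by metis
    moreover have "label t = ({..<n}, time t)"
      using R by (metis prod.collapse)
    moreover have "\<forall>s\<in>internal_nodes t. 2 \<le> size (children s)"
      "\<forall>s\<in>internal_nodes t. vset s = (\<Union>c\<in>set_mset (children s). vset c)"
      using inner by fastforce+
    ultimately show ?thesis
      using assms unfolding time_dependent_assembly_tree_def complete_graph_def Let_def by simp blast
  qed
  ultimately show ?L by blast
qed

section \<open>Cutting a tree at a given time\<close>

primrec frontier :: "nat \<Rightarrow> 'a assembly_tree \<Rightarrow> 'a assembly_tree set" where
  "frontier k (Node l ts) =
     (if snd l \<le> k then {Node l ts} else \<Union> (set_mset (image_mset (frontier k) ts)))"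

lemma frontier_le: "time t \<le> k \<Longrightarrow> frontier k t = {t}"
  by (cases t) auto

text \<open>
  The maximal subtrees at an earlier time lie below those at a later time, so the later frontier
  determines the earlier one.
\<close>

lemma frontier_cut_again: "k \<le> j \<Longrightarrow> (\<Union>s\<in>frontier j t. frontier k s) = frontier k t"
  by (induction t) auto

lemma frontier_merge_tree:
  "merge_tree t \<Longrightarrow> finite (frontier k t) \<and> frontier k t \<noteq> {} \<and>
    (\<forall>s\<in>frontier k t. merge_tree s \<and> time s \<le> k) \<and>
    disjoint_family_on vset (frontier k t) \<and> (\<Union>s\<in>frontier k t. vset s) = vset t"
proof (induction rule: merge_tree.induct)
  case (leaf v)
  then show ?case by (auto intro: merge_tree.leaf simp: disjoint_family_on_def)
next
  case (join c1 c2 i)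
  show ?case
  proof (cases "i \<le> k")
    case True
    then show ?thesis
      using join by (auto intro!: merge_tree.join simp: disjoint_family_on_def)
  next
    case False
    have "disjoint_family_on vset (frontier k c1 \<union> frontier k c2)"
      unfolding disjoint_family_on_def
    proof (intro ballI impI)
      fix s s' assume s: "s \<in> frontier k c1 \<union> frontier k c2" "s' \<in> frontier k c1 \<union> frontier k c2"
        "s \<noteq> s'"
      show "vset s \<inter> vset s' = {}"
        using s join(3,6,7) unfolding disjoint_family_on_def by blast
    qed
    then show ?thesis
      using False join by auto
  qed
qed

lemma node_in_frontier: "merge_tree t \<Longrightarrow> s \<in> nodes t \<Longrightarrow> s \<in> frontier (time s) t"
proof (induction rule: merge_tree.induct)
  case (join c1 c2 i)
  have "time s < i" if "s \<in> nodes c1 \<union> nodes c2"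
    using that merge_tree_nodes join by fastforce
  then show ?case using join by auto
qed auto

definition leaves :: "'a set \<Rightarrow> 'a assembly_tree set" where
  "leaves A = (\<lambda>v. Node ({v}, 0) {#}) ` A"

lemma frontier_0: "merge_tree t \<Longrightarrow> frontier 0 t = leaves (vset t)"
  by (induction rule: merge_tree.induct) (auto simp: leaves_def)

text \<open>
  What a frontier at time \<open>k\<close> can look like. The last condition records that no time has been skipped
  up to \<open>k\<close>; it is needed for a forest that consists of one tree to be a gapless tree whose root has
  time exactly \<open>k\<close>.
\<close>

definition forest :: "nat \<Rightarrow> 'a assembly_tree set \<Rightarrow> bool" where
  "forest k F \<longleftrightarrow> finite F \<and> (\<forall>s\<in>F. merge_tree s \<and> time s \<le> k) \<and> disjoint_family_on vset F \<and>
     {..k} \<subseteq> time ` (\<Union>s\<in>F. nodes s)"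

text \<open>
  Meant for a set \<open>e\<close> of two trees: the set becomes the multiset of children, so that \<open>e\<close> can be
  recovered from the joined tree.
\<close>

definition join_pair :: "nat \<Rightarrow> 'a assembly_tree set \<Rightarrow> 'a assembly_tree" where
  "join_pair k e = Node (\<Union>s\<in>e. vset s, Suc k) (mset_set e)"

definition merge_pairs ::
  "nat \<Rightarrow> 'a assembly_tree set \<Rightarrow> 'a assembly_tree set set \<Rightarrow> 'a assembly_tree set" where
  "merge_pairs k F M = (F - \<Union>M) \<union> join_pair k ` M"

definition completions :: "nat \<Rightarrow> 'a assembly_tree set \<Rightarrow> 'a assembly_tree set" where
  "completions k F = {t. merge_tree t \<and> gapless t \<and> frontier k t = F}"

lemma join_pair_properties:
  assumes "forest k F" "e \<subseteq> F" "card e = 2"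
  shows "merge_tree (join_pair k e)" "frontier k (join_pair k e) = e"
    "nodes (join_pair k e) = insert (join_pair k e) (\<Union>s\<in>e. nodes s)"
    "set_mset (children (join_pair k e)) = e" "time (join_pair k e) = Suc k"
    "vset (join_pair k e) = (\<Union>s\<in>e. vset s)"
proof -
  obtain c1 c2 where e: "e = {c1, c2}" "c1 \<noteq> c2"
    using assms(3) by (auto simp: card_2_iff)
  have c: "merge_tree c1" "merge_tree c2" "time c1 \<le> k" "time c2 \<le> k" "vset c1 \<inter> vset c2 = {}"
    using assms e by (auto simp: forest_def disjoint_family_on_def)
  have eq: "join_pair k e = Node (vset c1 \<union> vset c2, Suc k) {#c1, c2#}"
    using e by (simp add: join_pair_def)
  show "merge_tree (join_pair k e)"
    unfolding eq using c by (intro merge_tree.join) auto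
  show "frontier k (join_pair k e) = e" "nodes (join_pair k e) = insert (join_pair k e) (\<Union>s\<in>e. nodes s)"
    "set_mset (children (join_pair k e)) = e" "time (join_pair k e) = Suc k"
    "vset (join_pair k e) = (\<Union>s\<in>e. vset s)"
    unfolding eq using c e(1) by (auto simp: frontier_le)
qed

lemma eq_join_pair:
  assumes "merge_tree s" "time s = Suc k"
  shows "card (set_mset (children s)) = 2" "join_pair k (set_mset (children s)) = s"
    "frontier k s = set_mset (children s)"
    "\<forall>c\<in>#children s. merge_tree c \<and> vset c \<subseteq> vset s"
proof -
  from assms(1) obtain c1 c2 where s: "s = Node (vset c1 \<union> vset c2, Suc k) {#c1, c2#}"
    and c: "merge_tree c1" "merge_tree c2" "vset c1 \<inter> vset c2 = {}" "time c1 < Suc k" "time c2 < Suc k"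
  proof cases
    case (leaf v)
    then show ?thesis using assms(2) by simp
  next
    case (join c1 c2 i)
    then have "i = Suc k" using assms(2) by simp
    with join show ?thesis by (intro that[of c1 c2]) simp_all
  qed
  have ne: "c1 \<noteq> c2"
    using c merge_tree_finite_nonempty by auto
  show "card (set_mset (children s)) = 2" "join_pair k (set_mset (children s)) = s"
    "frontier k s = set_mset (children s)"
    "\<forall>c\<in>#children s. merge_tree c \<and> vset c \<subseteq> vset s"
    using ne c by (auto simp: s join_pair_def frontier_le)
qed

lemma disjoint_familyD: "disjoint_family_on f F \<Longrightarrow> x \<in> F \<Longrightarrow> y \<in> F \<Longrightarrow> z \<in> f x \<Longrightarrow> z \<in> f y \<Longrightarrow> x = y"
  by (auto simp: disjoint_family_on_def)

text \<open>
  The joined pairs are the only trees of the new forest with root time \<open>Suc k\<close>, since all the old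
  roots have times at most \<open>k\<close>. So the new forest determines the pairs, which makes the union over
  all choices of pairs a disjoint one.
\<close>

lemma joins_recoverable:
  assumes "forest k F" "M \<in> matchings F i"
  shows "(\<lambda>s. set_mset (children s)) ` {s \<in> merge_pairs k F M. time s = Suc k} = M"
proof -
  have F: "time s \<noteq> Suc k" if "s \<in> F" for s using assms(1) that by (auto simp: forest_def)
  have M: "set_mset (children (join_pair k e)) = e" "time (join_pair k e) = Suc k" if "e \<in> M" for e
    using join_pair_properties[OF assms(1)] assms(2) that by (auto simp: matchings_def)
  have "{s \<in> merge_pairs k F M. time s = Suc k} = join_pair k ` M"
    using F M by (auto simp: merge_pairs_def)
  with M show ?thesis by (simp add: image_image)
qed

lemma card_merge_pairs:
  assumes "forest k F" "M \<in> matchings F i"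
  shows "card (merge_pairs k F M) = card F - i"
proof -
  have fin: "finite F" "finite M"
    using assms finite_matching by (auto simp: forest_def)
  have F: "time s \<noteq> Suc k" if "s \<in> F" for s using assms(1) that by (auto simp: forest_def)
  have M: "set_mset (children (join_pair k e)) = e" "time (join_pair k e) = Suc k" if "e \<in> M" for e
    using join_pair_properties[OF assms(1)] assms(2) that by (auto simp: matchings_def)
  have "inj_on (join_pair k) M"
    using M by (metis inj_onI)
  then have "card (join_pair k ` M) = i"
    using assms(2) by (simp add: card_image matchings_def)
  moreover have "card (F - \<Union>M) = card F - 2 * i"
    using Union_matching[OF fin(1) assms(2)] fin by (simp add: card_Diff_subset finite_subset)
  moreover have "card (merge_pairs k F M) = card (F - \<Union>M) + card (join_pair k ` M)"
    unfolding merge_pairs_def using F M fin by (intro card_Un_disjoint) auto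
  ultimately show ?thesis
    using Union_matching(3)[OF fin(1) assms(2)] by simp
qed

lemma forest_merge_pairs:
  assumes "forest k F" "M \<in> matchings F i" "M \<noteq> {}"
  shows "forest (Suc k) (merge_pairs k F M)"
proof -
  have "finite M" using assms finite_matching by (auto simp: forest_def)
  have M: "e \<subseteq> F" "card e = 2" if "e \<in> M" for e using assms(2) that by (auto simp: matchings_def)
  note J = join_pair_properties[OF assms(1) M]
  have disF: "s = s'" if "s \<in> F" "s' \<in> F" "v \<in> vset s" "v \<in> vset s'" for s s' v
    using disjoint_familyD[of vset F] assms(1) that by (auto simp: forest_def)
  have disM: "e = e'" if "e \<in> M" "e' \<in> M" "s \<in> e" "s \<in> e'" for e e' s
    using assms(2) that unfolding matchings_def disjoint_def by blast
  have "s = s'" if s: "s \<in> merge_pairs k F M" "s' \<in> merge_pairs k F M" "v \<in> vset s" "v \<in> vset s'" for s s' v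
  proof -
    have in_join: "\<exists>c\<in>e. v \<in> vset c" if "v \<in> vset (join_pair k e)" "e \<in> M" for e
      using that J(6) by auto
    from s(1,2) show ?thesis unfolding merge_pairs_def
    proof (elim UnE imageE)
      assume "s \<in> F - \<Union>M" "s' \<in> F - \<Union>M"
      then show ?thesis using disF s by blast
    next
      fix e assume "s \<in> F - \<Union>M" "s' = join_pair k e" "e \<in> M"
      then show ?thesis using in_join[of e] disF[of s _ v] s M(1)[of e] by blast
    next
      fix e assume "s' \<in> F - \<Union>M" "s = join_pair k e" "e \<in> M"
      then show ?thesis using in_join[of e] disF[of s' _ v] s M(1)[of e] by blast
    next
      fix e e' assume "s = join_pair k e" "e \<in> M" "s' = join_pair k e'" "e' \<in> M"
      then show ?thesis
        using in_join[of e] in_join[of e'] disF[of _ _ v] disM[of e e'] s M(1)[of e] M(1)[of e'] by blast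
    qed
  qed
  then have "disjoint_family_on vset (merge_pairs k F M)"
    unfolding disjoint_family_on_def by blast
  moreover have "\<forall>s\<in>merge_pairs k F M. merge_tree s \<and> time s \<le> Suc k"
    using assms(1) J(1,5) by (auto simp: merge_pairs_def forest_def)
  moreover have "{..Suc k} \<subseteq> time ` (\<Union>s\<in>merge_pairs k F M. nodes s)"
  proof -
    have "(\<Union>s\<in>F. nodes s) \<subseteq> (\<Union>s\<in>merge_pairs k F M. nodes s)"
      using J(3) by (fastforce simp: merge_pairs_def)
    from image_mono[OF this, of time]
    have "{..k} \<subseteq> time ` (\<Union>s\<in>merge_pairs k F M. nodes s)"
      using assms(1) unfolding forest_def by (meson order_trans)
    moreover have "Suc k \<in> time ` (\<Union>s\<in>merge_pairs k F M. nodes s)"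
    proof -
      obtain e where e: "e \<in> M" using assms(3) by blast
      have "join_pair k e \<in> merge_pairs k F M"
        using e by (simp add: merge_pairs_def)
      then have "join_pair k e \<in> (\<Union>s\<in>merge_pairs k F M. nodes s)"
        using self_in_nodes by blast
      then show ?thesis
        using J(5)[OF e e] by (metis image_eqI)
    qed
    ultimately show ?thesis by (auto simp: atMost_Suc)
  qed
  ultimately show ?thesis
    using assms(1) \<open>finite M\<close> by (simp add: forest_def merge_pairs_def)
qed

text \<open>
  A tree whose root has time beyond \<open>k\<close> has a frontier with at least two members, one from each
  child of the root.
\<close>

lemma completions_singleton:
  assumes "forest k {s}"
  shows "completions k {s} = {s}"
proof -
  have s: "merge_tree s" "time s \<le> k" "{..k} \<subseteq> time ` nodes s"
    using assms by (auto simp: forest_def)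
  have "\<exists>u\<in>nodes s. time u = i" if "i \<le> time s" for i
  proof -
    have "i \<in> {..k}" using that s(2) by simp
    with s(3) have "i \<in> time ` nodes s" by (rule subsetD)
    then show ?thesis by (rule imageE) blast
  qed
  then have "s \<in> completions k {s}"
    using s(1,2) by (simp add: completions_def gapless_def frontier_le)
  moreover have "t = s" if t: "merge_tree t" "frontier k t = {s}" for t
  proof (cases "time t \<le> k")
    case True
    then show ?thesis using t frontier_le by fastforce
  next
    case False
    with t(1) obtain c1 c2 where c: "t = Node (vset c1 \<union> vset c2, time t) {#c1, c2#}"
      "merge_tree c1" "merge_tree c2" "vset c1 \<inter> vset c2 = {}"
      by cases auto
    have "frontier k t = frontier k c1 \<union> frontier k c2"
      using False by (subst c(1)) simp
    with t(2) have "frontier k c1 \<union> frontier k c2 = {s}"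
      by simp
    then have "frontier k c1 = {s}" "frontier k c2 = {s}"
      using frontier_merge_tree[OF c(2), of k] frontier_merge_tree[OF c(3), of k]
      by (simp_all add: Un_singleton_iff)
    then have "vset s = vset c1" "vset s = vset c2"
      using frontier_merge_tree[OF c(2), of k] frontier_merge_tree[OF c(3), of k] by simp_all
    then show ?thesis using c(4) merge_tree_finite_nonempty[OF c(2)] by simp
  qed
  ultimately show ?thesis by (auto simp: completions_def)
qed

text \<open>
  The pairs are the sets of children of the nodes with time \<open>Suc k\<close>. Such children have times at most
  \<open>k\<close>, so they belong to the earlier frontier; there is at least one pair because the tree has no
  gaps.
\<close>

lemma frontier_Suc_eq_merge_pairs:
  assumes "merge_tree t" "gapless t" "k < time t"
  shows "\<exists>i M. M \<in> matchings (frontier k t) i \<and> M \<noteq> {} \<and>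
    frontier (Suc k) t = merge_pairs k (frontier k t) M"
proof -
  define F G where "F = frontier k t" and "G = frontier (Suc k) t"
  define M where "M = (\<lambda>s. set_mset (children s)) ` {s \<in> G. time s = Suc k}"
  have G: "finite G" "\<And>s. s \<in> G \<Longrightarrow> merge_tree s" "\<And>s. s \<in> G \<Longrightarrow> time s \<le> Suc k"
    "disjoint_family_on vset G"
    using frontier_merge_tree[OF assms(1), of "Suc k"] by (auto simp: G_def)
  note J = eq_join_pair[OF G(2)]
  have dis: "s = s'" if s: "s \<in> G" "time s = Suc k" "c \<in># children s"
    and s': "s' \<in> G" "time s' = Suc k" "c \<in># children s'" for s s' c
  proof -
    obtain v where "v \<in> vset c"
      using J(4)[OF s(1,2)] s(3) merge_tree_finite_nonempty by blast
    then show ?thesis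
      using J(4)[OF s(1,2)] J(4)[OF s'(1,2)] s(3) s'(3) disjoint_familyD[OF G(4) s(1) s'(1)] by blast
  qed
  have "F = (\<Union>s\<in>G. frontier k s)"
    unfolding F_def G_def by (rule frontier_cut_again[symmetric]) simp
  also have "\<dots> = {s \<in> G. time s \<le> k} \<union> (\<Union>s\<in>{s \<in> G. time s = Suc k}. frontier k s)"
    using G(3) frontier_le by (fastforce simp: le_Suc_eq)
  also have "(\<Union>s\<in>{s \<in> G. time s = Suc k}. frontier k s) = \<Union>M"
    using J(3) by (auto simp: M_def)
  finally have F: "F = {s \<in> G. time s \<le> k} \<union> \<Union>M" .
  \<comment> \<open>A tree that persists has its vertices to itself, so it is not a child of a newly joined tree.\<close>
  have low: "s \<notin> \<Union>M" if s: "s \<in> G" "time s \<le> k" for s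
  proof
    assume "s \<in> \<Union>M"
    then obtain s' where s': "s' \<in> G" "time s' = Suc k" "s \<in># children s'" by (auto simp: M_def)
    obtain v where "v \<in> vset s" using merge_tree_finite_nonempty[OF G(2)[OF s(1)]] by blast
    then have "s = s'"
      using disjoint_familyD[OF G(4) s(1) s'(1)] J(4)[OF s'(1,2)] s'(3) by blast
    with s s' show False by simp
  qed
  have "M \<in> matchings F (card M)"
  proof -
    have "disjoint M"
      unfolding M_def disjoint_def using dis by blast
    moreover have "\<forall>e\<in>M. e \<subseteq> F \<and> card e = 2"
      using J(1) F by (auto simp: M_def)
    ultimately show ?thesis by (simp add: matchings_def)
  qed
  moreover have "M \<noteq> {}"
  proof -
    from assms(3) have "Suc k \<le> time t" by simp
    then obtain s where "s \<in> nodes t" "time s = Suc k"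
      using assms(2) unfolding gapless_def by blast
    then have "s \<in> G" using node_in_frontier[OF assms(1)] by (metis G_def)
    then show ?thesis using \<open>time s = Suc k\<close> by (auto simp: M_def)
  qed
  moreover have "G = merge_pairs k F M"
  proof -
    have "join_pair k ` M = {s \<in> G. time s = Suc k}"
      using J(2) by (force simp: M_def image_image)
    moreover have "F - \<Union>M = {s \<in> G. time s \<le> k}"
      using F low by blast
    ultimately show ?thesis
      using G(3) by (auto simp: merge_pairs_def le_Suc_eq)
  qed
  ultimately show ?thesis by (auto simp: F_def G_def)
qed

text \<open>
  With at least two trees, the forest is not yet complete, so time \<open>Suc k\<close> occurs in every
  completion and some pair is joined there. Conversely, cutting the joined forest at \<open>k\<close> again gives
  back the forest before joining.
\<close>

lemma completions_eq_UN:
  assumes "forest k F" "card F \<ge> 2"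
  shows "completions k F =
    (\<Union>M\<in>(\<Union>i\<in>{1..card F div 2}. matchings F i). completions (Suc k) (merge_pairs k F M))"
    (is "_ = ?U")
proof
  have fin: "finite F" using assms by (simp add: forest_def)
  show "completions k F \<subseteq> ?U"
  proof
    fix t assume "t \<in> completions k F"
    then have t: "merge_tree t" "gapless t" "frontier k t = F" by (auto simp: completions_def)
    have "k < time t"
      using t(3) assms(2) frontier_le[of t k] by (cases "time t \<le> k") auto
    then obtain i M where M: "M \<in> matchings F i" "M \<noteq> {}" "frontier (Suc k) t = merge_pairs k F M"
      using frontier_Suc_eq_merge_pairs t by metis
    have "i \<noteq> 0"
      using M finite_matching[OF fin M(1)] by (auto simp: matchings_def)
    moreover have "i \<le> card F div 2"
      using Union_matching(3)[OF fin M(1)] by simp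
    ultimately have "i \<in> {1..card F div 2}" by simp
    moreover have "t \<in> completions (Suc k) (merge_pairs k F M)"
      using t M by (simp add: completions_def)
    ultimately show "t \<in> ?U" using M(1) by blast
  qed
  show "?U \<subseteq> completions k F"
  proof clarify
    fix t M i assume M: "M \<in> matchings F i" and "t \<in> completions (Suc k) (merge_pairs k F M)"
    then have t: "merge_tree t" "gapless t" "frontier (Suc k) t = merge_pairs k F M"
      by (auto simp: completions_def)
    have "frontier k t = (\<Union>s\<in>merge_pairs k F M. frontier k s)"
      unfolding t(3)[symmetric] by (rule frontier_cut_again[symmetric]) simp
    also have "\<dots> = (\<Union>s\<in>F - \<Union>M. frontier k s) \<union> (\<Union>e\<in>M. frontier k (join_pair k e))"
      by (auto simp: merge_pairs_def)
    also have "(\<Union>s\<in>F - \<Union>M. frontier k s) = F - \<Union>M"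
      using assms(1) frontier_le by (fastforce simp: forest_def)
    also have "(\<Union>e\<in>M. frontier k (join_pair k e)) = \<Union>M"
      using join_pair_properties(2)[OF assms(1)] M by (auto simp: matchings_def)
    finally have "frontier k t = F" using Union_matching(1)[OF fin M] by blast
    with t show "t \<in> completions k F" by (simp add: completions_def)
  qed
qed

section \<open>The recurrence\<close>

lemma forest_leaves:
  assumes "finite A" "A \<noteq> {}"
  shows "forest 0 (leaves A)" "card (leaves A) = card A"
proof -
  obtain v where "v \<in> A" using assms(2) by blast
  then have "Node ({v}, 0) {#} \<in> (\<Union>s\<in>leaves A. nodes s)" by (auto simp: leaves_def)
  then have "0 \<in> time ` (\<Union>s\<in>leaves A. nodes s)" by force
  then show "forest 0 (leaves A)"
    using assms(1)
    by (auto simp: forest_def leaves_def disjoint_family_on_def intro!: merge_tree.leaf)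
  show "card (leaves A) = card A"
    unfolding leaves_def by (intro card_image) (simp add: inj_on_def)
qed

lemma num_complete_graph_1: "num_edge_assembly_trees (complete_graph 1) = 1"
proof -
  have "{t. time_dependent_assembly_tree (complete_graph 1) t \<and> edge_gluing_rule (complete_graph 1) t}
      = {Node ({..<1}, 0) {#}}"
    by (auto simp: time_dependent_assembly_tree_def complete_graph_def edge_gluing_rule_def
        internal_nodes_def)
  then show ?thesis by (simp add: num_edge_assembly_trees_def)
qed

lemma num_complete_graph_eq_completions:
  assumes "n \<ge> 2"
  shows "num_edge_assembly_trees (complete_graph n) =
    card (completions 0 (leaves {..<n}))"
proof -
  have "frontier 0 t = leaves {..<n} \<longleftrightarrow> vset t = {..<n}" if "merge_tree t" for t
    unfolding frontier_0[OF that] leaves_def by (rule inj_image_eq_iff) (simp add: inj_def)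
  then show ?thesis
    unfolding num_edge_assembly_trees_def completions_def assembly_tree_complete_graph_iff[OF assms]
    by (metis (no_types, lifting))
qed

text \<open>
  The weights \<open>a\<close> stand for the counts of smaller forests. They are kept abstract since the step is
  used twice: inside the induction that shows that these counts depend on the size only, and once
  more to obtain the recurrence from the result of that induction.
\<close>

lemma card_completions_step:
  fixes F :: "'a assembly_tree set"
  assumes "forest k F" "card F \<ge> 2"
    and IH: "\<And>j (G :: 'a assembly_tree set). forest j G \<Longrightarrow> 1 \<le> card G \<Longrightarrow> card G < card F \<Longrightarrow>
      finite (completions j G) \<and> card (completions j G) = a (card G)"
  shows "finite (completions k F) \<and> card (completions k F) =
    (\<Sum>i = 1..card F div 2. card (matchings F i) * a (card F - i))"
proof -
  let ?I = "{1..card F div 2}"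
  let ?N = "\<Union>i\<in>?I. matchings F i"
  let ?C = "\<lambda>M. completions (Suc k) (merge_pairs k F M)"
  have fin: "finite F" using assms by (simp add: forest_def)
  have finN: "finite ?N" using finite_matchings[OF fin] by blast
  have C: "finite (?C M) \<and> card (?C M) = a (card F - i)" if "i \<in> ?I" "M \<in> matchings F i" for i M
  proof -
    have "M \<noteq> {}" using that by (auto simp: matchings_def)
    have "i < card F" using that(1) assms(2) by auto
    have "forest (Suc k) (merge_pairs k F M)"
      using \<open>M \<noteq> {}\<close> forest_merge_pairs assms(1) that by blast
    with IH[OF this] show ?thesis
      using card_merge_pairs[OF assms(1) that(2)] \<open>i < card F\<close> that(1) by simp
  qed
  have "inj_on (merge_pairs k F) ?N"
  proof (rule inj_onI)
    fix M M' assume "M \<in> ?N" "M' \<in> ?N" and eq: "merge_pairs k F M = merge_pairs k F M'"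
    then obtain i i' where M: "M \<in> matchings F i" "M' \<in> matchings F i'" by blast
    show "M = M'"
      using joins_recoverable[OF assms(1) M(1)] joins_recoverable[OF assms(1) M(2)]
      unfolding eq by simp
  qed
  then have dis: "\<forall>M\<in>?N. \<forall>M'\<in>?N. M \<noteq> M' \<longrightarrow> ?C M \<inter> ?C M' = {}"
    unfolding inj_on_def completions_def by blast
  have "card (completions k F) = (\<Sum>M\<in>?N. card (?C M))"
    unfolding completions_eq_UN[OF assms(1,2)]
    by (rule card_UN_disjoint[OF finN _ dis]) (use C in blast)
  also have "\<dots> = (\<Sum>i\<in>?I. \<Sum>M\<in>matchings F i. card (?C M))"
    using finite_matchings[OF fin] by (intro sum.UNION_disjoint) (auto simp: matchings_def)
  also have "\<dots> = (\<Sum>i\<in>?I. \<Sum>M\<in>matchings F i. a (card F - i))"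
    using C by (intro sum.cong) auto
  finally have "card (completions k F) = (\<Sum>i\<in>?I. card (matchings F i) * a (card F - i))"
    by simp
  moreover have "finite (completions k F)"
    unfolding completions_eq_UN[OF assms(1,2)] using finN C by blast
  ultimately show ?thesis by simp
qed

lemma card_matchings_cong:
  assumes "finite A" "finite B" "card A = card B" "2 * i \<le> card A"
  shows "card (matchings A i) = card (matchings B i)"
  using card_matchings[OF assms(1,4)] card_matchings[of B i] assms by simp

text \<open>
  The number of completions depends on the number of trees alone. In the induction step the given
  forest is compared with the forest of \<open>card F\<close> leaves: by the step above both satisfy the same
  recursion, and the completions of the latter are the assembly trees of the complete graph.
\<close>

lemma card_completions:
  fixes F :: "nat assembly_tree set"
  assumes "forest k F" "1 \<le> card F"
  shows "finite (completions k F) \<and>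
    card (completions k F) = num_edge_assembly_trees (complete_graph (card F))"
  using assms
proof (induction "card F" arbitrary: k F rule: less_induct)
  case less
  show ?case
  proof (cases "card F = 1")
    case True
    then obtain s where "F = {s}" by (auto simp: card_1_singleton_iff)
    then show ?thesis
      using less.prems completions_singleton[of k s] num_complete_graph_1 by simp
  next
    case False
    let ?a = "\<lambda>i. num_edge_assembly_trees (complete_graph i)"
    let ?L = "leaves {..<card F}"
    have L: "forest 0 ?L" "card ?L = card F" and finL: "finite ?L"
      using forest_leaves[of "{..<card F}"] less.prems(2) by (auto simp: forest_def lessThan_empty_iff)
    have finF: "finite F" and two: "card F \<ge> 2"
      using False less.prems by (auto simp: forest_def)
    have step: "finite (completions j G) \<and>
        card (completions j G) = (\<Sum>i = 1..card F div 2. card (matchings G i) * ?a (card F - i))"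
      if "forest j G" "card G = card F" for j and G :: "nat assembly_tree set"
      using card_completions_step[of j G ?a] that two less.hyps by simp
    have "card (matchings F i) = card (matchings ?L i)" if "i \<in> {1..card F div 2}" for i
      by (rule card_matchings_cong[OF finF finL]) (use that L(2) in auto)
    then have "card (completions k F) = card (completions 0 ?L)"
      using step[OF less.prems(1)] step[OF L] by simp
    then show ?thesis
      using step[OF less.prems(1)] num_complete_graph_eq_completions[OF two] by simp
  qed
qed

lemma num_complete_graph_recurrence:
  assumes "n \<ge> 2"
  shows "real (num_edge_assembly_trees (complete_graph n)) =
    (\<Sum>i = 1..n div 2. fact n / (2 ^ i * fact i * fact (n - 2 * i)) *
      real (num_edge_assembly_trees (complete_graph (n - i))))"
proof -
  let ?L = "leaves {..<n}"
  let ?a = "\<lambda>i. num_edge_assembly_trees (complete_graph i)"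
  have L: "forest 0 ?L" "card ?L = n"
    using forest_leaves[of "{..<n}"] assms by (auto simp: lessThan_empty_iff)
  have "?a n = (\<Sum>i = 1..n div 2. card (matchings ?L i) * ?a (n - i))"
    using card_completions_step[OF L(1), of ?a] card_completions L(2) assms
    unfolding num_complete_graph_eq_completions[OF assms] by metis
  also have "real \<dots> = (\<Sum>i = 1..n div 2. real (card (matchings ?L i)) * real (?a (n - i)))"
    by simp
  also have "\<dots> = (\<Sum>i = 1..n div 2. fact n / (2 ^ i * fact i * fact (n - 2 * i)) * real (?a (n - i)))"
  proof (rule sum.cong)
    fix i assume "i \<in> {1..n div 2}"
    then have "2 * i \<le> n" by auto
    then show "real (card (matchings ?L i)) * real (?a (n - i)) =
        fact n / (2 ^ i * fact i * fact (n - 2 * i)) * real (?a (n - i))"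
      using card_matchings[of ?L i] L by (simp add: forest_def)
  qed simp
  finally show ?thesis .
qed

theorem proposition4p13:
  shows "num_edge_assembly_trees (complete_graph 1) = 1 \<and>
    num_edge_assembly_trees (complete_graph 2) = 1 \<and>
    (\<forall>n::nat. n \<ge> 3 \<longrightarrow>
      real (num_edge_assembly_trees (complete_graph n)) =
        (\<Sum>i = 1..n div 2.
           fact n / (2 ^ i * fact i * fact (n - 2 * i)) *
           real (num_edge_assembly_trees (complete_graph (n - i)))))"
proof (intro conjI allI impI)
  show "num_edge_assembly_trees (complete_graph 1) = 1"
    by (rule num_complete_graph_1)
  then show "num_edge_assembly_trees (complete_graph 2) = 1"
    using num_complete_graph_recurrence[of 2] by (simp add: numeral_2_eq_2)
next
  fix n :: nat assume "n \<ge> 3"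
  then show "real (num_edge_assembly_trees (complete_graph n)) =
        (\<Sum>i = 1..n div 2.
           fact n / (2 ^ i * fact i * fact (n - 2 * i)) *
           real (num_edge_assembly_trees (complete_graph (n - i))))"
    by (intro num_complete_graph_recurrence) simp
qed

end
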